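(* Let $S'_1=(g^{(1)}_{j_1},h^{(1)},g^{(2)}_{j_2},h^{(2)})$ and $S'_2=(g^{(3)}_{j_3},h^{(3)},g^{(4)}_{j_4},h^{(4)})$ be reduced couplings with $j_1,j_2,j_3,j_4\in\{1,3,5\}$, not all equal to $1$. If $Z(S'_1)\times_{\{x_1,x_3\}}Z(S'_2)$ is an infinite set, then, up to a relabeling (i.e. after replacing $(j_1,j_2,j_3,j_4)$ by one of its cyclic shifts), one of the following holds (as multisets): (a) $\{j_1,j_2\}=\{1,3\}$ and $\{j_3,j_4\}=\{1,5\}$; (b) $\{j_1,j_2\}=\{3,5\}$ and $\{j_3,j_4\}=\{3,5\}$.
   Context: Indices $i\in\{1,2,3,4\}$ are taken modulo 4 (so $x_5=x_1$). For each $i$ fix $f_i\in(-1,1]$ and put $h^{(i)}(y_i,x_{i+1})=(1-f_i^2)(y_i-x_{i+1})-2f_i(y_ix_{i+1}+1)$. Consider real polynomials $$g_1^{(i)}=x_iy_i-k_i,\qquad g_3^{(i)}=a_ix_iy_i^2+b_ix_i+y_i,\qquad g_5^{(i)}=a_ix_i^2y_i+c_iy_i+x_i,$$ with all coefficients nonzero real numbers satisfying $k_i\notin\{0,\pm1\}$, $|b_i-a_i|<1$ (for $g_3^{(i)}$), $|c_i-a_i|<1$ (for $g_5^{(i)}$). A reduced coupling is an ideal generated by $g^{(i)}_{j_i},h^{(i)},g^{(i+1)}_{j_{i+1}},h^{(i+1)}$ in $\mathbb{C}[x_i,x_{i+1},x_{i+2},y_i,y_{i+1}]$. For a reduced coupling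 $S'$, $Z(S')\subset(\mathbb{C}P^1)^5$ is the common zero set of its four generators, zeros with coordinates equal to $\infty$ being understood by homogenizing each generator separately in each of its two variables. The fiber product $Z(S'_1)\times_{\{x_1,x_3\}}Z(S'_2)$ is the set of pairs of points of $Z(S_1')$ and $Z(S_2')$ having the same $x_1$-coordinate and the same $x_3$-coordinate. A relabeling is the renaming of the indices $1,2,3,4$ by an element of the cyclic group generated by the permutation $(1234)$, applied simultaneously to all polynomials and variables. *)

theory Defs
  imports Complex_Main "HOL-Computational_Algebra.Polynomial" "HOL-Library.Multiset"
begin

section \<open>The complex projective line\<close>

definition proj_rel :: "complex \<times> complex \<Rightarrow> complex \<times> complex \<Rightarrow> bool" where
  "proj_rel p q \<longleftrightarrow> p \<noteq> (0, 0) \<and> (\<exists>t. t \<noteq> 0 \<and> q = (t * fst p, t * snd p))"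

lemma proj_rel_part_equivp: "part_equivp proj_rel"
proof (rule part_equivpI)
  show "\<exists>x. proj_rel x x"
    by (rule exI[of _ "(1, 0)"]) (auto simp: proj_rel_def intro: exI[of _ 1])
  show "symp proj_rel"
  proof (rule sympI)
    fix p q assume "proj_rel p q"
    then obtain t where t: "p \<noteq> (0, 0)" "t \<noteq> 0" "q = (t * fst p, t * snd p)"
      by (auto simp: proj_rel_def)
    then show "proj_rel q p"
      unfolding proj_rel_def by (cases p) (auto intro!: exI[of _ "inverse t"])
  qed
  show "transp proj_rel"
  proof (rule transpI)
    fix p q r assume pq: "proj_rel p q" and qr: "proj_rel q r"
    from pq obtain s where s: "p \<noteq> (0, 0)" "s \<noteq> 0" "q = (s * fst p, s * snd p)"
      unfolding proj_rel_def by (elim conjE exE)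
    from qr obtain t where t: "t \<noteq> 0" "r = (t * fst q, t * snd q)"
      unfolding proj_rel_def by (elim conjE exE)
    have "r = ((t * s) * fst p, (t * s) * snd p)" "t * s \<noteq> 0"
      using s t by simp_all
    with s(1) show "proj_rel p r"
      unfolding proj_rel_def by (intro conjI exI[of _ "t * s"])
  qed
qed

quotient_type cp1 = "complex \<times> complex" / partial: proj_rel
  by (rule proj_rel_part_equivp)

text \<open>The point \<open>[z : 1]\<close>, i.e. the finite coordinate \<open>z\<close>, and the point \<open>[1 : 0]\<close>.\<close>

lift_definition cp1_of_complex :: "complex \<Rightarrow> cp1" is "\<lambda>z. (z, 1)"
  by (auto simp: proj_rel_def intro: exI[of _ 1])

lift_definition cp1_infinity :: cp1 is "(1, 0)"
  by (auto simp: proj_rel_def intro: exI[of _ 1])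

lemma cp1_cases: "p = cp1_infinity \<or> (\<exists>z. p = cp1_of_complex z)"
proof (transfer)
  fix p :: "complex \<times> complex" assume p: "proj_rel p p"
  show "proj_rel p (1, 0) \<or> (\<exists>z. proj_rel p (z, 1))"
  proof (cases "snd p = 0")
    case True
    with p have "proj_rel p (1, 0)"
      by (cases p) (auto simp: proj_rel_def intro!: exI[of _ "inverse (fst p)"])
    then show ?thesis ..
  next
    case False
    with p have "proj_rel p (fst p / snd p, 1)"
      by (cases p) (auto simp: proj_rel_def field_simps intro!: exI[of _ "inverse (snd p)"])
    then show ?thesis by blast
  qed
qed

lemma cp1_of_complex_inject: "cp1_of_complex z = cp1_of_complex w \<longleftrightarrow> z = w"
  by transfer (auto simp: proj_rel_def)

lemma cp1_of_complex_neq_infinity: "cp1_of_complex z \<noteq> cp1_infinity"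
  by transfer (auto simp: proj_rel_def)


section \<open>Bivariate polynomials and their zeros on the product of two projective lines\<close>

text \<open>A polynomial in two variables \<open>u, v\<close> is an element of \<open>\<complex>[u][v]\<close>: the coefficient of
  \<open>u^m v^n\<close> in \<open>p\<close> is \<open>coeff (coeff p n) m\<close>.\<close>

type_synonym bipoly = "complex poly poly"

definition varU :: bipoly where "varU = [:[:0, 1:]:]"
definition varV :: bipoly where "varV = [:0, 1:]"
definition rconst :: "real \<Rightarrow> bipoly" where "rconst r = [:[:of_real r:]:]"

definition degU :: "bipoly \<Rightarrow> nat" where
  "degU p = Max ((\<lambda>n. degree (coeff p n)) ` {..degree p})"

definition bihom :: "bipoly \<Rightarrow> complex \<times> complex \<Rightarrow> complex \<times> complex \<Rightarrow> complex" where
  "bihom p s t = (\<Sum>n\<le>degree p. \<Sum>m\<le>degU p. coeff (coeff p n) m *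
     (fst s ^ m * snd s ^ (degU p - m)) * (fst t ^ n * snd t ^ (degree p - n)))"

lemma degree_coeff_le_degU: "degree (coeff p n) \<le> degU p"
proof (cases "n \<le> degree p")
  case True
  then show ?thesis unfolding degU_def by (intro Max_ge) auto
qed (simp add: coeff_eq_0)

lemma bihom_scale:
  "bihom p (a * fst s, a * snd s) (b * fst t, b * snd t)
     = a ^ degU p * b ^ degree p * bihom p s t"
proof -
  have *: "(c * x) ^ m * (c * y) ^ (d - m) = c ^ d * (x ^ m * y ^ (d - m))"
    if "m \<le> d" for c x y :: complex and m d
  proof -
    have "c ^ d = c ^ m * c ^ (d - m)" using that by (simp flip: power_add)
    then show ?thesis by (simp add: power_mult_distrib)
  qed
  show ?thesis
    unfolding bihom_def sum_distrib_left by (intro sum.cong refl) (simp add: *)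
qed

lift_definition vanishes_at :: "bipoly \<Rightarrow> cp1 \<Rightarrow> cp1 \<Rightarrow> bool" is
  "\<lambda>p s t. bihom p s t = 0"
  unfolding proj_rel_def by (elim conjE exE) (simp add: bihom_scale)

lemma vanishes_at_finite:
  "vanishes_at p (cp1_of_complex z) (cp1_of_complex w) \<longleftrightarrow> poly (poly p [:w:]) z = 0"
proof -
  have inner: "poly (coeff p n) z = (\<Sum>m\<le>degU p. coeff (coeff p n) m * z ^ m)" for n
    unfolding poly_altdef
  proof (rule sum.mono_neutral_left)
    show "{..degree (coeff p n)} \<subseteq> {..degU p}"
      using degree_coeff_le_degU[of p n] by auto
    show "\<forall>m\<in>{..degU p} - {..degree (coeff p n)}. coeff (coeff p n) m * z ^ m = 0"
      using coeff_eq_0[of "coeff p n"] by auto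
  qed simp
  have "poly (poly p [:w:]) z = (\<Sum>n\<le>degree p. poly (coeff p n) z * w ^ n)"
    unfolding poly_altdef[of p] poly_sum poly_mult poly_power by simp
  also have "\<dots> = bihom p (z, 1) (w, 1)"
    unfolding inner bihom_def sum_distrib_right by (intro sum.cong refl) simp
  finally have "poly (poly p [:w:]) z = bihom p (z, 1) (w, 1)" .
  moreover have "vanishes_at p (cp1_of_complex z) (cp1_of_complex w) \<longleftrightarrow> bihom p (z, 1) (w, 1) = 0"
    by transfer (rule refl)
  ultimately show ?thesis by (simp only:)
qed


section \<open>Reduced couplings\<close>

text \<open>In \<open>g1\<close>, \<open>g3\<close>, \<open>g5\<close> the variables \<open>(u, v)\<close> are \<open>(x_i, y_i)\<close>; in \<open>hpoly\<close> they are
  \<open>(y_i, x_{i+1})\<close>.\<close>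

definition g1 :: "real \<Rightarrow> bipoly" where
  "g1 k = varU * varV - rconst k"

definition g3 :: "real \<Rightarrow> real \<Rightarrow> bipoly" where
  "g3 a b = rconst a * varU * varV ^ 2 + rconst b * varU + varV"

definition g5 :: "real \<Rightarrow> real \<Rightarrow> bipoly" where
  "g5 a c = rconst a * varU ^ 2 * varV + rconst c * varV + varU"

definition hpoly :: "real \<Rightarrow> bipoly" where
  "hpoly f = rconst (1 - f ^ 2) * (varU - varV) - rconst (2 * f) * (varU * varV + 1)"

lemma generators_at_finite:
  "poly (poly (g1 k) [:y:]) x = x * y - of_real k"
  "poly (poly (g3 a b) [:y:]) x = of_real a * x * y ^ 2 + of_real b * x + y"
  "poly (poly (g5 a c) [:y:]) x = of_real a * x ^ 2 * y + of_real c * y + x"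
  "poly (poly (hpoly f) [:x':]) y =
     (1 - of_real f ^ 2) * (y - x') - 2 * of_real f * (y * x' + 1)"
  by (simp_all add: g1_def g3_def g5_def hpoly_def varU_def varV_def rconst_def
      power2_eq_square algebra_simps)

text \<open>The type \<open>j\<close> ranges over \<open>{1, 3, 5}\<close>; each type uses only the coefficients occurring in its
  polynomial, and only these are constrained.\<close>

definition gpoly :: "nat \<Rightarrow> real \<Rightarrow> real \<Rightarrow> real \<Rightarrow> real \<Rightarrow> bipoly" where
  "gpoly j k a b c = (if j = 1 then g1 k else if j = 3 then g3 a b else g5 a c)"

definition admissible :: "nat \<Rightarrow> real \<Rightarrow> real \<Rightarrow> real \<Rightarrow> real \<Rightarrow> bool" where
  "admissible j k a b c \<longleftrightarrow>
     (j = 1 \<and> k \<notin> {0, 1, -1}) \<or>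
     (j = 3 \<and> a \<noteq> 0 \<and> b \<noteq> 0 \<and> \<bar>b - a\<bar> < 1) \<or>
     (j = 5 \<and> a \<noteq> 0 \<and> c \<noteq> 0 \<and> \<bar>c - a\<bar> < 1)"

text \<open>A reduced coupling enters only through the zero set of its four generators
  \<open>g(x_i, y_i)\<close>, \<open>h(y_i, x_{i+1})\<close>, \<open>g'(x_{i+1}, y_{i+1})\<close>, \<open>h'(y_{i+1}, x_{i+2})\<close>, and is given by them.
  The zeros are listed as \<open>(x_i, x_{i+1}, x_{i+2}, y_i, y_{i+1})\<close>.\<close>

type_synonym coupling = "bipoly \<times> bipoly \<times> bipoly \<times> bipoly"
type_synonym cp1_5 = "cp1 \<times> cp1 \<times> cp1 \<times> cp1 \<times> cp1"

fun coupling_zeros :: "coupling \<Rightarrow> cp1_5 set" where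
  "coupling_zeros (g, h, g', h') = {(x, x', x'', y, y').
     vanishes_at g x y \<and> vanishes_at h y x' \<and> vanishes_at g' x' y' \<and> vanishes_at h' y' x''}"

text \<open>\<open>x_1\<close> and \<open>x_3\<close> are the first and third coordinate on \<open>Z(S'_1)\<close>; on \<open>Z(S'_2)\<close> the first
  coordinate is \<open>x_3\<close> and the third is \<open>x_5 = x_1\<close>.\<close>

definition fiber_product :: "coupling \<Rightarrow> coupling \<Rightarrow> (cp1_5 \<times> cp1_5) set" where
  "fiber_product S1 S2 =
     {((x1, x2, x3, y1, y2), (x3', x4, x1', y3, y4)).
        (x1, x2, x3, y1, y2) \<in> coupling_zeros S1 \<and>
        (x3', x4, x1', y3, y4) \<in> coupling_zeros S2 \<and> x1 = x1' \<and> x3 = x3'}"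

text \<open>The cycle \<open>(1 2 3 4)\<close> on \<open>{1, 2, 3, 4}\<close>.\<close>

definition cycle4 :: "nat \<Rightarrow> nat" where "cycle4 i = i mod 4 + 1"

end

theory Submission
  imports Defs "HOL-Computational_Algebra.Fundamental_Theorem_Algebra"
    "HOL-Computational_Algebra.Polynomial_Factorial" "HOL-Computational_Algebra.Field_as_Ring"
begin

text \<open>Going around the indices, a point of the fiber product is a closed chain
  \<open>x\<^sub>1, y\<^sub>1, x\<^sub>2, y\<^sub>2, x\<^sub>3, y\<^sub>3, x\<^sub>4, y\<^sub>4, x\<^sub>1\<close> of points of the projective line in which neighbours are
  related by \<open>g\<^sup>(\<^sup>i\<^sup>)\<close> and \<open>h\<^sup>(\<^sup>i\<^sup>)\<close> alternately. The zero set of \<open>h\<close> and that of a \<open>g\<close> of type 1 are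
  graphs of Moebius maps. A \<open>g\<close> of type 5 makes \<open>y = - x / (a x\<^sup>2 + c)\<close> a function of degree 2 of
  \<open>x\<close>; a \<open>g\<close> of type 3 makes, the other way round, \<open>x = - y / (a y\<^sup>2 + b)\<close> a function of degree 2
  of \<open>y\<close>. So passing from \<open>x\<^sub>i\<close> to \<open>x\<^sub>i\<^sub>+\<^sub>1\<close> multiplies degrees by 1, 2 or 1/2 for the types 1, 5 and 3,
  and an infinite family of closed chains forces the product of these factors to be 1: there are
  as many indices of type 3 as of type 5. Up to cyclic shifts, the two cases in the conclusion
  are exactly the type vectors with this property other than \<open>(1, 1, 1, 1)\<close> (\<open>balanced_types\<close>).

  With four indices, the degree count needs no function fields. If the numbers of threes and of
  fives differ, then one of them is at most one, and after reversing the direction of the chain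
  (which exchanges the types 3 and 5) and rotating it, three consecutive steps are maps in the
  forward direction, and the fourth is a map in one of the two directions. The whole chain is then
  determined by its first point \<open>z\<close>, and its closing is an equation \<open>R z = S z\<close> between rational maps
  of different degrees. Cross-multiplying, it becomes a polynomial equation, which is not an
  identity because coprime numerator and denominator determine the degree
  (\<open>finite_coincidences\<close>, \<open>finite_loops_forward\<close>, \<open>finite_loops_unbalanced\<close>).\<close>

section \<open>Homogeneous coordinates and the zero sets of the generators\<close>

text \<open>The point \<open>[s : t]\<close>; meaningful only for \<open>(s, t) \<noteq> (0, 0)\<close>.\<close>

definition pt :: "complex \<Rightarrow> complex \<Rightarrow> cp1" where
  "pt s t = abs_cp1 (s, t)"

lemma pt_eq_iff:
  assumes "s \<noteq> 0 \<or> t \<noteq> 0" "u \<noteq> 0 \<or> v \<noteq> 0"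
  shows "pt s t = pt u v \<longleftrightarrow> s * v = t * u"
proof -
  have rel: "proj_rel (s, t) (s, t)" "proj_rel (u, v) (u, v)"
    using assms by (auto simp: proj_rel_def intro: exI[of _ 1])
  have "pt s t = pt u v \<longleftrightarrow> proj_rel (s, t) (u, v)"
    using Quotient3_rel[OF Quotient3_cp1, of "(s, t)" "(u, v)"] rel by (simp add: pt_def)
  also have "\<dots> \<longleftrightarrow> s * v = t * u"
  proof
    assume "proj_rel (s, t) (u, v)"
    then show "s * v = t * u" by (auto simp: proj_rel_def)
  next
    assume eq: "s * v = t * u"
    have "\<exists>r. r \<noteq> 0 \<and> u = r * s \<and> v = r * t"
    proof (cases "s = 0")
      case True
      with assms eq have "t \<noteq> 0" "u = 0" "v \<noteq> 0" by auto
      with True show ?thesis by (intro exI[of _ "v / t"]) simp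
    next
      case False
      with eq have v: "v = u / s * t" by (simp add: nonzero_eq_divide_eq mult.commute)
      with assms(2) have "u \<noteq> 0" by auto
      with False v show ?thesis by (intro exI[of _ "u / s"]) simp
    qed
    with assms(1) show "proj_rel (s, t) (u, v)" by (auto simp: proj_rel_def)
  qed
  finally show ?thesis .
qed

lemma cp1_of_complex_eq_pt: "cp1_of_complex z = pt z 1"
  by (simp add: pt_def cp1_of_complex.abs_eq)

lemma cp1_infinity_eq_pt: "cp1_infinity = pt 1 0"
  by (simp add: pt_def cp1_infinity.abs_eq)

lemma pt_cases:
  obtains s t where "p = pt s t" "s \<noteq> 0 \<or> t \<noteq> 0"
proof -
  consider "p = cp1_infinity" | z where "p = cp1_of_complex z" using cp1_cases by blast
  then show ?thesis
  proof cases
    case 1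
    then show ?thesis using that[of 1 0] by (simp add: cp1_infinity_eq_pt)
  next
    case (2 z)
    then show ?thesis using that[of z 1] by (simp add: cp1_of_complex_eq_pt)
  qed
qed

lemma vanishes_at_pt:
  assumes "s \<noteq> 0 \<or> t \<noteq> 0" "u \<noteq> 0 \<or> v \<noteq> 0"
  shows "vanishes_at p (pt s t) (pt u v) \<longleftrightarrow> bihom p (s, t) (u, v) = 0"
proof -
  have "proj_rel (s, t) (s, t)" "proj_rel (u, v) (u, v)"
    using assms by (auto simp: proj_rel_def intro: exI[of _ 1])
  then show ?thesis by (simp add: pt_def vanishes_at.abs_eq)
qed

text \<open>The homogenization depends on the actual degrees in the two variables, so each generator has
  to be shown to attain its expected bidegree. For \<open>hpoly f\<close> this holds even in the cases
  \<open>f = 0\<close> and \<open>f\<^sup>2 = 1\<close>, where one of its two parts disappears.\<close>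

lemma bihom_bidegree_1_1:
  assumes p: "p = [:[:c00, c10:], [:c01, c11:]:]"
    and U: "c10 \<noteq> 0 \<or> c11 \<noteq> 0" and V: "c01 \<noteq> 0 \<or> c11 \<noteq> 0"
  shows "bihom p (s, t) (u, v) = c00 * t * v + c10 * s * v + c01 * t * u + c11 * s * u"
proof -
  have "degree p = 1" using V by (auto simp: p)
  moreover have "degU p = 1"
    using U V unfolding degU_def \<open>degree p = 1\<close> by (auto simp: p atMost_Suc)
  ultimately show ?thesis by (simp add: bihom_def p atMost_Suc algebra_simps)
qed

lemma bihom_g3:
  assumes "a \<noteq> 0"
  shows "bihom (g3 a b) (s, t) (u, v)
           = s * (of_real a * u ^ 2 + of_real b * v ^ 2) + t * u * v"
proof -
  have p: "g3 a b = [:[:0, of_real b:], [:1:], [:0, of_real a:]:]"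
    by (simp add: g3_def varU_def varV_def rconst_def power2_eq_square one_pCons)
  have "degree (g3 a b) = 2" using assms by (simp add: p)
  moreover have "degU (g3 a b) = 1"
    using assms unfolding degU_def \<open>degree (g3 a b) = 2\<close>
    by (auto simp: p atMost_Suc numeral_2_eq_2)
  ultimately show ?thesis
    by (simp add: bihom_def p atMost_Suc numeral_2_eq_2 algebra_simps)
qed

lemma bihom_g5:
  assumes "a \<noteq> 0"
  shows "bihom (g5 a c) (s, t) (u, v)
           = u * (of_real a * s ^ 2 + of_real c * t ^ 2) + v * s * t"
proof -
  have p: "g5 a c = [:[:0, 1:], [:of_real c, 0, of_real a:]:]"
    by (simp add: g5_def varU_def varV_def rconst_def power2_eq_square)
  have "degree (g5 a c) = 1" using assms by (simp add: p)
  moreover have "degU (g5 a c) = 2"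
    using assms unfolding degU_def \<open>degree (g5 a c) = 1\<close>
    by (auto simp: p atMost_Suc numeral_2_eq_2)
  ultimately show ?thesis
    by (simp add: bihom_def p atMost_Suc numeral_2_eq_2 algebra_simps)
qed

lemma bihom_g1: "bihom (g1 k) (s, t) (u, v) = s * u - of_real k * t * v"
proof -
  have "g1 k = [:[:- of_real k, 0:], [:0, 1:]:]"
    by (simp add: g1_def varU_def varV_def rconst_def)
  from bihom_bidegree_1_1[OF this] show ?thesis by simp
qed

lemma bihom_hpoly:
  "bihom (hpoly f) (s, t) (u, v)
     = (1 - of_real f ^ 2) * (s * v - t * u) - 2 * of_real f * (s * u + t * v)"
proof -
  have "hpoly f = [:[:- (2 * of_real f), 1 - (of_real f)\<^sup>2:],
                    [:- (1 - (of_real f)\<^sup>2), - (2 * of_real f):]:]"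
    by (simp add: hpoly_def varU_def varV_def rconst_def one_pCons)
  note expand = bihom_bidegree_1_1[OF this]
  show ?thesis
    by (subst expand) (auto simp: algebra_simps)
qed

section \<open>Rational maps of given degree\<close>

text \<open>The map \<open>z \<mapsto> [P z : Q z]\<close> on the affine line, for \<open>P\<close> and \<open>Q\<close> without common root and with
  \<open>max (degree P) (degree Q) = d\<close>. The degree is prescribed by means of the pair of coefficients at \<open>d\<close>
  because \<open>[coeff P d : coeff Q d]\<close> is the value of the map at infinity. Thus both conditions
  say that the homogeneous coordinates of a value are not both zero, and both are preserved under a
  further map for the same reason.\<close>

definition rational_map :: "nat \<Rightarrow> (complex \<Rightarrow> cp1) \<Rightarrow> bool" where
  "rational_map d X \<longleftrightarrow> (\<exists>P Q. degree P \<le> d \<and> degree Q \<le> d \<and>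
     (coeff P d \<noteq> 0 \<or> coeff Q d \<noteq> 0) \<and>
     (\<forall>z. poly P z \<noteq> 0 \<or> poly Q z \<noteq> 0) \<and> (\<forall>z. X z = pt (poly P z) (poly Q z)))"

lemma rational_map_id: "rational_map 1 cp1_of_complex"
  unfolding rational_map_def
  by (rule exI[of _ "[:0, 1:]"], rule exI[of _ 1]) (simp add: cp1_of_complex_eq_pt)

lemma rational_map_const: "rational_map 0 (\<lambda>_. p)"
proof -
  obtain s t where "p = pt s t" "s \<noteq> 0 \<or> t \<noteq> 0" by (rule pt_cases)
  then show ?thesis unfolding rational_map_def
    by (intro exI[of _ "[:s:]"] exI[of _ "[:t:]"]) simp
qed

lemma coprime_if_no_common_root:
  fixes P Q :: "complex poly"
  assumes "\<forall>z. poly P z \<noteq> 0 \<or> poly Q z \<noteq> 0"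
  shows "coprime P Q"
proof (rule coprimeI)
  fix R assume "R dvd P" "R dvd Q"
  then have no_root: "poly R z \<noteq> 0" for z
    using assms by (auto simp: dvd_def)
  then have "constant (poly R)"
    using fundamental_theorem_of_algebra by blast
  then have "degree R = 0" by (simp add: constant_degree)
  moreover have "R \<noteq> 0" using no_root[of 0] by auto
  ultimately show "is_unit R" by (simp add: is_unit_iff_degree)
qed

text \<open>If \<open>[P : Q]\<close> and \<open>[R : S]\<close> agreed identically, then \<open>P S = Q R\<close>, and coprimality would make
  \<open>P, R\<close> and \<open>Q, S\<close> associated, hence the degrees equal. So \<open>P S - Q R\<close> is a nonzero polynomial, and
  the coincidences are its roots.\<close>

lemma finite_coincidences:
  assumes X: "rational_map d X" and Y: "rational_map e Y" and "d \<noteq> e"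
  shows "finite {z. X z = Y z}"
proof -
  obtain P Q where P: "degree P \<le> d" "degree Q \<le> d" "coeff P d \<noteq> 0 \<or> coeff Q d \<noteq> 0"
      "\<forall>z. poly P z \<noteq> 0 \<or> poly Q z \<noteq> 0" "\<forall>z. X z = pt (poly P z) (poly Q z)"
    using X unfolding rational_map_def by metis
  obtain R S where R: "degree R \<le> e" "degree S \<le> e" "coeff R e \<noteq> 0 \<or> coeff S e \<noteq> 0"
      "\<forall>z. poly R z \<noteq> 0 \<or> poly S z \<noteq> 0" "\<forall>z. Y z = pt (poly R z) (poly S z)"
    using Y unfolding rational_map_def by metis
  have d: "d = max (degree P) (degree Q)" and e: "e = max (degree R) (degree S)"
    using P(1-3) R(1-3) le_degree by fastforce+
  have "P * S - Q * R \<noteq> 0"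
  proof
    assume "P * S - Q * R = 0"
    then have eq: "P * S = Q * R" by simp
    have PQ: "coprime P Q" and RS: "coprime R S"
      using P(4) R(4) by (auto intro: coprime_if_no_common_root)
    have dvd: "P dvd Q * R" "R dvd P * S" "Q dvd P * S" "S dvd Q * R"
      using eq dvd_triv_left[of P S] dvd_triv_right[of S P] by simp_all
    have "P dvd R" using dvd(1) PQ by (simp add: coprime_dvd_mult_right_iff)
    moreover have "R dvd P" using dvd(2) RS by (simp add: coprime_dvd_mult_left_iff)
    moreover have "Q dvd S"
      using dvd(3) PQ by (simp add: coprime_dvd_mult_right_iff coprime_commute)
    moreover have "S dvd Q"
      using dvd(4) RS by (simp add: coprime_dvd_mult_left_iff coprime_commute)
    moreover have "degree A = degree B" if "A dvd B" "B dvd A" for A B :: "complex poly"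
      using that by (cases "A = 0") (auto intro!: antisym dvd_imp_degree_le)
    ultimately have "degree P = degree R" "degree Q = degree S" by blast+
    with d e \<open>d \<noteq> e\<close> show False by simp
  qed
  then have "finite {z. poly (P * S - Q * R) z = 0}" by (rule poly_roots_finite)
  moreover have "{z. X z = Y z} = {z. poly (P * S - Q * R) z = 0}"
    using P(4,5) R(4,5) by (simp add: pt_eq_iff)
  ultimately show ?thesis by simp
qed

section \<open>Relations that are graphs of maps of given degree\<close>

type_synonym cp1_rel = "cp1 \<Rightarrow> cp1 \<Rightarrow> bool"

text \<open>The relation \<open>E\<close> behaves like the graph of a morphism of degree \<open>m\<close>, expressed by its effect on
  rational maps from the affine line: following \<open>E\<close> from a map of degree \<open>d\<close> leaves
  at most one possibility, which is a map of degree \<open>m d\<close>. In this form compositions need no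
  argument about composing polynomials. The constant maps (\<open>d = 0\<close>) are included, which is what makes
  \<open>E\<close> single-valued at every point, infinity included.\<close>

definition graph_of_degree :: "nat \<Rightarrow> cp1_rel \<Rightarrow> bool" where
  "graph_of_degree m E \<longleftrightarrow> (\<forall>d X. rational_map d X \<longrightarrow>
     (\<exists>Y. rational_map (m * d) Y \<and> (\<forall>z q. E (X z) q \<longrightarrow> q = Y z)))"

lemma graph_of_degreeE:
  assumes "graph_of_degree m E" "rational_map d X"
  obtains Y where "rational_map (m * d) Y" "\<And>z q. E (X z) q \<Longrightarrow> q = Y z"
  using assms unfolding graph_of_degree_def by metis

lemma graph_of_degree_functional:
  assumes "graph_of_degree m E" "E p q" "E p q'"
  shows "q = q'"
  using assms(1) rational_map_const[of p] by (rule graph_of_degreeE) (use assms in metis)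

lemma graph_of_degree_OO:
  assumes E: "graph_of_degree m E" and F: "graph_of_degree n F"
  shows "graph_of_degree (m * n) (E OO F)"
  unfolding graph_of_degree_def
proof (intro allI impI)
  fix d X assume "rational_map d X"
  with E obtain Y where Y: "rational_map (m * d) Y" "\<And>z q. E (X z) q \<Longrightarrow> q = Y z"
    by (rule graph_of_degreeE) blast
  from F Y(1) obtain Z where "rational_map (n * (m * d)) Z" "\<And>z q. F (Y z) q \<Longrightarrow> q = Z z"
    by (rule graph_of_degreeE) blast
  with Y show "\<exists>Z. rational_map (m * n * d) Z \<and> (\<forall>z q. (E OO F) (X z) q \<longrightarrow> q = Z z)"
    by (intro exI[of _ Z]) (auto simp: ac_simps)
qed

lemma coeff_mult_at_degree_bounds:
  fixes P Q :: "'a :: comm_semiring_0 poly"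
  assumes "degree P \<le> m" "degree Q \<le> n"
  shows "coeff (P * Q) (m + n) = coeff P m * coeff Q n"
proof -
  have "coeff (P * Q) (m + n) = (\<Sum>i\<le>m + n. coeff P i * coeff Q (m + n - i))"
    by (simp add: coeff_mult)
  also have "\<dots> = (\<Sum>i\<in>{m}. coeff P i * coeff Q (m + n - i))"
  proof (rule sum.mono_neutral_right)
    show "\<forall>i\<in>{..m + n} - {m}. coeff P i * coeff Q (m + n - i) = 0"
    proof
      fix i assume "i \<in> {..m + n} - {m}"
      then consider "i < m" | "i > m" by fastforce
      then show "coeff P i * coeff Q (m + n - i) = 0"
        using assms by cases (simp_all add: coeff_eq_0)
    qed
  qed auto
  finally show ?thesis by simp
qed

lemma quadratic_pair_nonzero:
  fixes s t \<alpha> \<gamma> :: complex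
  assumes "\<alpha> \<noteq> 0" "\<gamma> \<noteq> 0" "s \<noteq> 0 \<or> t \<noteq> 0"
  shows "- (s * t) \<noteq> 0 \<or> \<alpha> * s ^ 2 + \<gamma> * t ^ 2 \<noteq> 0"
  using assms by auto

lemma linear_pair_nonzero:
  fixes s t :: complex
  assumes "\<alpha> * \<delta> - \<beta> * \<gamma> \<noteq> 0" "s \<noteq> 0 \<or> t \<noteq> 0"
  shows "\<alpha> * s + \<beta> * t \<noteq> 0 \<or> \<gamma> * s + \<delta> * t \<noteq> 0"
proof (rule ccontr)
  assume "\<not> ?thesis"
  then have 0: "\<alpha> * s + \<beta> * t = 0" "\<gamma> * s + \<delta> * t = 0" by auto
  have "(\<alpha> * \<delta> - \<beta> * \<gamma>) * s = \<delta> * (\<alpha> * s + \<beta> * t) - \<beta> * (\<gamma> * s + \<delta> * t)"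
       "(\<alpha> * \<delta> - \<beta> * \<gamma>) * t = \<alpha> * (\<gamma> * s + \<delta> * t) - \<gamma> * (\<alpha> * s + \<beta> * t)"
    by (simp_all add: algebra_simps)
  with 0 assms show False by auto
qed

text \<open>In homogeneous coordinates \<open>[s : t]\<close> is sent to \<open>[\<alpha> s + \<beta> t : \<gamma> s + \<delta> t]\<close>. That the new pair is
  nonzero is applied to the values at each \<open>z\<close> and, for the degree, to the coefficients at \<open>d\<close>.\<close>

lemma graph_of_degree_1_moebius:
  assumes det: "\<alpha> * \<delta> - \<beta> * \<gamma> \<noteq> 0"
    and E: "\<And>s t u v. s \<noteq> 0 \<or> t \<noteq> 0 \<Longrightarrow> u \<noteq> 0 \<or> v \<noteq> 0 \<Longrightarrow>
      E (pt s t) (pt u v) \<Longrightarrow> u * (\<gamma> * s + \<delta> * t) = v * (\<alpha> * s + \<beta> * t)"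
  shows "graph_of_degree 1 E"
  unfolding graph_of_degree_def
proof (intro allI impI)
  fix d X assume "rational_map d X"
  then obtain P Q where P: "degree P \<le> d" "degree Q \<le> d" "coeff P d \<noteq> 0 \<or> coeff Q d \<noteq> 0"
      "\<forall>z. poly P z \<noteq> 0 \<or> poly Q z \<noteq> 0" "\<forall>z. X z = pt (poly P z) (poly Q z)"
    unfolding rational_map_def by metis
  define A where "A = smult \<alpha> P + smult \<beta> Q"
  define B where "B = smult \<gamma> P + smult \<delta> Q"
  have deg: "degree A \<le> d" "degree B \<le> d"
    using P(1,2) unfolding A_def B_def by (meson degree_add_le degree_smult_le order_trans)+
  have top: "coeff A d \<noteq> 0 \<or> coeff B d \<noteq> 0"
    using linear_pair_nonzero[OF det P(3)] by (simp add: A_def B_def)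
  have nz: "poly A z \<noteq> 0 \<or> poly B z \<noteq> 0" for z
    using linear_pair_nonzero[OF det] P(4) by (simp add: A_def B_def)
  have "q = pt (poly A z) (poly B z)" if "E (X z) q" for z q
  proof -
    obtain u v where q: "q = pt u v" "u \<noteq> 0 \<or> v \<noteq> 0" by (rule pt_cases)
    with that E[of "poly P z" "poly Q z" u v] P(4,5)
    have "u * poly B z = v * poly A z" by (simp add: A_def B_def)
    with q nz show ?thesis by (simp add: pt_eq_iff)
  qed
  with deg top nz
  show "\<exists>Y. rational_map (1 * d) Y \<and> (\<forall>z q. E (X z) q \<longrightarrow> q = Y z)"
    unfolding rational_map_def
    by (intro exI[of _ "\<lambda>z. pt (poly A z) (poly B z)"]) auto
qed

text \<open>In homogeneous coordinates \<open>[s : t]\<close> is sent to \<open>[- s t : \<alpha> s\<^sup>2 + \<gamma> t\<^sup>2]\<close>. Since \<open>\<alpha>\<close> and \<open>\<gamma>\<close> are nonzero,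
  the two forms have no common zero, so no factor cancels and the degree doubles exactly.\<close>

lemma graph_of_degree_2_quadratic:
  assumes nz: "\<alpha> \<noteq> 0" "\<gamma> \<noteq> 0"
    and E: "\<And>s t u v. s \<noteq> 0 \<or> t \<noteq> 0 \<Longrightarrow> u \<noteq> 0 \<or> v \<noteq> 0 \<Longrightarrow>
      E (pt s t) (pt u v) \<Longrightarrow> u * (\<alpha> * s ^ 2 + \<gamma> * t ^ 2) + v * s * t = 0"
  shows "graph_of_degree 2 E"
  unfolding graph_of_degree_def
proof (intro allI impI)
  fix d X assume "rational_map d X"
  then obtain P Q where P: "degree P \<le> d" "degree Q \<le> d" "coeff P d \<noteq> 0 \<or> coeff Q d \<noteq> 0"
      "\<forall>z. poly P z \<noteq> 0 \<or> poly Q z \<noteq> 0" "\<forall>z. X z = pt (poly P z) (poly Q z)"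
    unfolding rational_map_def by metis
  define A where "A = - (P * Q)"
  define B where "B = smult \<alpha> (P * P) + smult \<gamma> (Q * Q)"
  have "degree (R * S) \<le> d + d" if "R \<in> {P, Q}" "S \<in> {P, Q}" for R S
    using that P(1,2) by (auto intro!: order_trans[OF degree_mult_le] add_mono)
  then have "degree A \<le> d + d" "degree B \<le> d + d"
    unfolding A_def B_def degree_minus
    by (auto intro!: degree_add_le order_trans[OF degree_smult_le])
  then have deg: "degree A \<le> 2 * d" "degree B \<le> 2 * d" by simp_all
  have "coeff A (d + d) \<noteq> 0 \<or> coeff B (d + d) \<noteq> 0"
    using quadratic_pair_nonzero[OF nz P(3)] P(1,2)
    by (simp add: A_def B_def coeff_mult_at_degree_bounds power2_eq_square)
  then have top: "coeff A (2 * d) \<noteq> 0 \<or> coeff B (2 * d) \<noteq> 0" by (simp add: mult_2)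
  have nz': "poly A z \<noteq> 0 \<or> poly B z \<noteq> 0" for z
    using quadratic_pair_nonzero[OF nz P(4)[rule_format, of z]]
    by (simp add: A_def B_def power2_eq_square)
  have "q = pt (poly A z) (poly B z)" if "E (X z) q" for z q
  proof -
    obtain u v where q: "q = pt u v" "u \<noteq> 0 \<or> v \<noteq> 0" by (rule pt_cases)
    with that E[of "poly P z" "poly Q z" u v] P(4,5)
    have "u * poly B z + v * (poly P z * poly Q z) = 0"
      by (simp add: B_def power2_eq_square mult.assoc)
    then have "u * poly B z = v * poly A z"
      by (simp add: A_def eq_neg_iff_add_eq_0)
    with q nz' show ?thesis by (simp add: pt_eq_iff)
  qed
  with deg top nz'
  show "\<exists>Y. rational_map (2 * d) Y \<and> (\<forall>z q. E (X z) q \<longrightarrow> q = Y z)"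
    unfolding rational_map_def
    by (intro exI[of _ "\<lambda>z. pt (poly A z) (poly B z)"]) auto
qed

lemma graph_of_degree_g5:
  assumes "a \<noteq> 0" "c \<noteq> 0"
  shows "graph_of_degree 2 (vanishes_at (g5 a c))"
  by (rule graph_of_degree_2_quadratic[of "of_real a" "of_real c"])
    (use assms in \<open>simp_all add: vanishes_at_pt bihom_g5\<close>)

lemma graph_of_degree_g3:
  assumes "a \<noteq> 0" "b \<noteq> 0"
  shows "graph_of_degree 2 (vanishes_at (g3 a b))\<inverse>\<inverse>"
  by (rule graph_of_degree_2_quadratic[of "of_real a" "of_real b"])
    (use assms in \<open>simp_all add: vanishes_at_pt bihom_g3 ac_simps\<close>)

lemma graph_of_degree_g1:
  assumes "k \<noteq> 0"
  shows "graph_of_degree 1 (vanishes_at (g1 k))" "graph_of_degree 1 (vanishes_at (g1 k))\<inverse>\<inverse>"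
  by (rule graph_of_degree_1_moebius[of 0 0 "of_real k" 1];
      use assms in \<open>simp add: vanishes_at_pt bihom_g1 ac_simps\<close>)+

lemma graph_of_degree_hpoly:
  "graph_of_degree 1 (vanishes_at (hpoly f))" "graph_of_degree 1 (vanishes_at (hpoly f))\<inverse>\<inverse>"
proof -
  \<comment> \<open>The Moebius matrix is a rotation, by twice the arctangent of \<open>f\<close>, scaled by \<open>1 + f\<^sup>2\<close>.\<close>
  have "(1 - f\<^sup>2) * (1 - f\<^sup>2) - - (2 * f) * (2 * f) = (1 + f\<^sup>2)\<^sup>2"
    by (simp add: power2_eq_square algebra_simps)
  moreover have "1 + f\<^sup>2 > 0" by (simp add: add_pos_nonneg)
  ultimately have r: "(1 - f\<^sup>2) * (1 - f\<^sup>2) - - (2 * f) * (2 * f) \<noteq> 0" by simp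
  define \<phi> where "\<phi> = complex_of_real (1 - f\<^sup>2)"
  define \<psi> where "\<psi> = complex_of_real (2 * f)"
  have "\<phi> * \<phi> - - \<psi> * \<psi> = of_real ((1 - f\<^sup>2) * (1 - f\<^sup>2) - - (2 * f) * (2 * f))"
    by (simp add: \<phi>_def \<psi>_def)
  with r have det: "\<phi> * \<phi> - - \<psi> * \<psi> \<noteq> 0" "\<phi> * \<phi> - \<psi> * - \<psi> \<noteq> 0"
    by (simp_all only: of_real_eq_0_iff not_False_eq_True mult_minus_left mult_minus_right)
  have *: "vanishes_at (hpoly f) (pt s t) (pt u v) \<longleftrightarrow>
      u * (\<psi> * s + \<phi> * t) = v * (\<phi> * s + - \<psi> * t)"
    if "s \<noteq> 0 \<or> t \<noteq> 0" "u \<noteq> 0 \<or> v \<noteq> 0" for s t u v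
    using that by (auto simp: vanishes_at_pt bihom_hpoly \<phi>_def \<psi>_def algebra_simps)
  show "graph_of_degree 1 (vanishes_at (hpoly f))"
    by (rule graph_of_degree_1_moebius[OF det(1)]) (simp add: *)
  show "graph_of_degree 1 (vanishes_at (hpoly f))\<inverse>\<inverse>"
    by (rule graph_of_degree_1_moebius[OF det(2)]) (simp add: *, simp add: algebra_simps)
qed

section \<open>Closed chains\<close>

definition loops :: "cp1_rel \<Rightarrow> cp1_rel \<Rightarrow> cp1_rel \<Rightarrow> cp1_rel \<Rightarrow> (cp1 \<times> cp1 \<times> cp1 \<times> cp1) set" where
  "loops E1 E2 E3 E4 = {(x1, x2, x3, x4). E1 x1 x2 \<and> E2 x2 x3 \<and> E3 x3 x4 \<and> E4 x4 x1}"

lemma finite_loops_rotate: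
  assumes "finite (loops E2 E3 E4 E1)"
  shows "finite (loops E1 E2 E3 E4)"
proof -
  have "loops E1 E2 E3 E4 = (\<lambda>(x2, x3, x4, x1). (x1, x2, x3, x4)) ` loops E2 E3 E4 E1"
    by (force simp: loops_def)
  with assms show ?thesis by simp
qed

lemma finite_loops_reverse:
  assumes "finite (loops E4\<inverse>\<inverse> E3\<inverse>\<inverse> E2\<inverse>\<inverse> E1\<inverse>\<inverse>)"
  shows "finite (loops E1 E2 E3 E4)"
proof -
  have "loops E1 E2 E3 E4
      = (\<lambda>(x1, x4, x3, x2). (x1, x2, x3, x4)) ` loops E4\<inverse>\<inverse> E3\<inverse>\<inverse> E2\<inverse>\<inverse> E1\<inverse>\<inverse>"
    by (force simp: loops_def)
  with assms show ?thesis by simp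
qed

text \<open>The logarithm to base 2 of the factor by which \<open>E\<close> multiplies degrees, where a map
  in the backward direction counts negatively. For \<open>e = 0\<close> the relation is the graph of a map in
  both directions.\<close>

definition log_degree :: "int \<Rightarrow> cp1_rel \<Rightarrow> bool" where
  "log_degree e E \<longleftrightarrow> (e \<ge> 0 \<longrightarrow> graph_of_degree (2 ^ nat e) E) \<and>
     (e \<le> 0 \<longrightarrow> graph_of_degree (2 ^ nat (- e)) E\<inverse>\<inverse>)"

lemma log_degree_conversep: "log_degree e E \<Longrightarrow> log_degree (- e) E\<inverse>\<inverse>"
  by (simp add: log_degree_def)

text \<open>The first three relations make \<open>x\<^sub>2, x\<^sub>3, x\<^sub>4\<close> functions of \<open>x\<^sub>1\<close>. If the fourth is a map forwards, a loop is
  a fixed point of a rational map of degree different from 1. If it is one backwards, then \<open>x\<^sub>4\<close> is a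
  function of \<open>x\<^sub>1\<close> in two ways, of different degrees.\<close>

lemma finite_loops_forward:
  assumes E: "log_degree e1 E1" "log_degree e2 E2" "log_degree e3 E3" "log_degree e4 E4"
    and nonneg: "e1 \<ge> 0" "e2 \<ge> 0" "e3 \<ge> 0" and sum: "e1 + e2 + e3 + e4 \<noteq> 0"
  shows "finite (loops E1 E2 E3 E4)"
proof -
  have fwd: "graph_of_degree (2 ^ nat e1) E1" "graph_of_degree (2 ^ nat e2) E2"
      "graph_of_degree (2 ^ nat e3) E3"
    using E nonneg by (simp_all add: log_degree_def)
  have "graph_of_degree (2 ^ nat e1 * 2 ^ nat e2 * 2 ^ nat e3) (E1 OO E2 OO E3)"
    using graph_of_degree_OO[OF fwd(1) graph_of_degree_OO[OF fwd(2,3)]] by (simp add: mult.assoc)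
  then have E123: "graph_of_degree (2 ^ nat (e1 + e2 + e3)) (E1 OO E2 OO E3)"
    using nonneg by (simp add: nat_add_distrib power_add)
  have fin: "finite {z. \<exists>q. (E1 OO E2 OO E3) (cp1_of_complex z) q \<and> E4 q (cp1_of_complex z)}"
  proof (cases "e4 \<ge> 0")
    case True
    then have "graph_of_degree (2 ^ nat e4) E4" using E(4) by (simp add: log_degree_def)
    with E123 have "graph_of_degree (2 ^ nat (e1 + e2 + e3) * 2 ^ nat e4) ((E1 OO E2 OO E3) OO E4)"
      by (rule graph_of_degree_OO)
    then obtain Y where Y: "rational_map (2 ^ nat (e1 + e2 + e3) * 2 ^ nat e4 * 1) Y"
        "\<And>z q. ((E1 OO E2 OO E3) OO E4) (cp1_of_complex z) q \<Longrightarrow> q = Y z"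
      using rational_map_id by (rule graph_of_degreeE) blast
    have "2 ^ nat (e1 + e2 + e3) * 2 ^ nat e4 * 1 \<noteq> (1 :: nat)"
      using sum nonneg True by (auto simp flip: power_add)
    with rational_map_id Y(1) have "finite {z. cp1_of_complex z = Y z}"
      by (intro finite_coincidences) auto
    moreover have "cp1_of_complex z = Y z"
      if "(E1 OO E2 OO E3) (cp1_of_complex z) q" "E4 q (cp1_of_complex z)" for z q
      using that by (intro Y(2)) (rule relcomppI)
    ultimately show ?thesis by (auto elim!: rev_finite_subset simp del: relcompp_apply)
  next
    case False
    then have "graph_of_degree (2 ^ nat (- e4)) E4\<inverse>\<inverse>" using E(4) by (simp add: log_degree_def)
    then obtain Z where Z: "rational_map (2 ^ nat (- e4) * 1) Z"
        "\<And>z q. E4\<inverse>\<inverse> (cp1_of_complex z) q \<Longrightarrow> q = Z z"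
      using rational_map_id by (rule graph_of_degreeE) blast
    obtain Y where Y: "rational_map (2 ^ nat (e1 + e2 + e3) * 1) Y"
        "\<And>z q. (E1 OO E2 OO E3) (cp1_of_complex z) q \<Longrightarrow> q = Y z"
      using E123 rational_map_id by (rule graph_of_degreeE) blast
    have "2 ^ nat (e1 + e2 + e3) * 1 \<noteq> (2 ^ nat (- e4) * 1 :: nat)"
      using sum nonneg False by simp
    with Y(1) Z(1) have "finite {z. Y z = Z z}" by (intro finite_coincidences)
    moreover have "Y z = Z z"
      if "(E1 OO E2 OO E3) (cp1_of_complex z) q" "E4 q (cp1_of_complex z)" for z q
      using Y(2)[OF that(1)] Z(2)[of z q] that(2) by simp
    ultimately show ?thesis by (auto elim!: rev_finite_subset simp del: relcompp_apply)
  qed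
  have inj: "inj_on fst (loops E1 E2 E3 E4)"
  proof (rule inj_onI)
    fix l l' assume "l \<in> loops E1 E2 E3 E4" "l' \<in> loops E1 E2 E3 E4" "fst l = fst l'"
    then obtain x1 x2 x3 x4 x2' x3' x4' where l: "l = (x1, x2, x3, x4)" "l' = (x1, x2', x3', x4')"
      and "E1 x1 x2" "E2 x2 x3" "E3 x3 x4" "E1 x1 x2'" "E2 x2' x3'" "E3 x3' x4'"
      by (auto simp: loops_def)
    moreover from this have "x2' = x2" by (blast intro: graph_of_degree_functional[OF fwd(1)])
    moreover from calculation have "x3' = x3"
      by (blast intro: graph_of_degree_functional[OF fwd(2)])
    moreover from calculation have "x4' = x4"
      by (blast intro: graph_of_degree_functional[OF fwd(3)])
    ultimately show "l = l'" by simp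
  qed
  have "fst ` loops E1 E2 E3 E4 \<subseteq> insert cp1_infinity (cp1_of_complex `
      {z. \<exists>q. (E1 OO E2 OO E3) (cp1_of_complex z) q \<and> E4 q (cp1_of_complex z)})"
  proof
    fix x1 assume "x1 \<in> fst ` loops E1 E2 E3 E4"
    then obtain x2 x3 x4 where "E1 x1 x2" "E2 x2 x3" "E3 x3 x4" and E4: "E4 x4 x1"
      by (auto simp: loops_def)
    then have "(E1 OO E2 OO E3) x1 x4" by blast
    with E4
    show "x1 \<in> insert cp1_infinity (cp1_of_complex `
      {z. \<exists>q. (E1 OO E2 OO E3) (cp1_of_complex z) q \<and> E4 q (cp1_of_complex z)})"
      using cp1_cases[of x1] by (auto simp del: relcompp_apply)
  qed
  with fin have "finite (fst ` loops E1 E2 E3 E4)"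
    by (meson finite_insert finite_imageI finite_subset)
  with inj show ?thesis by (simp add: finite_image_iff)
qed

text \<open>Two exponents equal to \<open>-1\<close> would leave a sum of at most 0. So at most one is negative, and a
  rotation makes it the last one.\<close>

lemma finite_loops_positive:
  assumes E: "log_degree e1 E1" "log_degree e2 E2" "log_degree e3 E3" "log_degree e4 E4"
    and bound: "\<bar>e1\<bar> \<le> 1" "\<bar>e2\<bar> \<le> 1" "\<bar>e3\<bar> \<le> 1" "\<bar>e4\<bar> \<le> 1"
    and sum: "e1 + e2 + e3 + e4 > 0"
  shows "finite (loops E1 E2 E3 E4)"
proof -
  consider "e1 \<ge> 0" "e2 \<ge> 0" "e3 \<ge> 0" | "e2 \<ge> 0" "e3 \<ge> 0" "e4 \<ge> 0"
    | "e3 \<ge> 0" "e4 \<ge> 0" "e1 \<ge> 0" | "e4 \<ge> 0" "e1 \<ge> 0" "e2 \<ge> 0"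
    using bound sum by (smt (verit))
  then show ?thesis
  proof cases
    case 1
    with sum show ?thesis by (intro finite_loops_forward[OF E]) auto
  next
    case 2
    with sum have "finite (loops E2 E3 E4 E1)" by (intro finite_loops_forward[OF E(2,3,4,1)]) auto
    then show ?thesis by (rule finite_loops_rotate)
  next
    case 3
    with sum have "finite (loops E3 E4 E1 E2)" by (intro finite_loops_forward[OF E(3,4,1,2)]) auto
    then show ?thesis by (rule finite_loops_rotate[OF finite_loops_rotate])
  next
    case 4
    with sum have "finite (loops E4 E1 E2 E3)" by (intro finite_loops_forward[OF E(4,1,2,3)]) auto
    then show ?thesis by (rule finite_loops_rotate[OF finite_loops_rotate[OF finite_loops_rotate]])
  qed
qed

lemma finite_loops_unbalanced:
  assumes E: "log_degree e1 E1" "log_degree e2 E2" "log_degree e3 E3" "log_degree e4 E4"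
    and bound: "\<bar>e1\<bar> \<le> 1" "\<bar>e2\<bar> \<le> 1" "\<bar>e3\<bar> \<le> 1" "\<bar>e4\<bar> \<le> 1"
    and sum: "e1 + e2 + e3 + e4 \<noteq> 0"
  shows "finite (loops E1 E2 E3 E4)"
proof (cases "e1 + e2 + e3 + e4 > 0")
  case True
  with E bound show ?thesis by (rule finite_loops_positive)
next
  case False
  with sum have "- e4 + - e3 + - e2 + - e1 > 0" by linarith
  then have "finite (loops E4\<inverse>\<inverse> E3\<inverse>\<inverse> E2\<inverse>\<inverse> E1\<inverse>\<inverse>)"
    by (intro finite_loops_positive[OF E(4,3,2,1)[THEN log_degree_conversep]])
      (simp_all only: abs_minus_cancel bound)
  then show ?thesis by (rule finite_loops_reverse)
qed

section \<open>The fiber product\<close>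

definition type_exponent :: "nat \<Rightarrow> int" where
  "type_exponent j = (if j = 3 then -1 else if j = 5 then 1 else 0)"

definition link :: "bipoly \<Rightarrow> bipoly \<Rightarrow> cp1_rel" where
  "link g h = vanishes_at g OO vanishes_at h"

lemma log_degree_link:
  assumes "admissible j k a b c"
  shows "log_degree (type_exponent j) (link (gpoly j k a b c) (hpoly f))"
proof -
  note OO = graph_of_degree_OO[OF _ graph_of_degree_hpoly(1)]
    graph_of_degree_OO[OF graph_of_degree_hpoly(2)]
  from assms consider "j = 1" "k \<noteq> 0" | "j = 3" "a \<noteq> 0" "b \<noteq> 0" | "j = 5" "a \<noteq> 0" "c \<noteq> 0"
    by (auto simp: admissible_def)
  then show ?thesis
  proof cases
    case 1
    with OO(1)[OF graph_of_degree_g1(1)[of k]] OO(2)[OF graph_of_degree_g1(2)[of k]]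
    show ?thesis
      by (simp add: log_degree_def type_exponent_def link_def gpoly_def converse_relcompp)
  next
    case 2
    with OO(2)[OF graph_of_degree_g3[of a b]] show ?thesis
      by (simp add: log_degree_def type_exponent_def link_def gpoly_def converse_relcompp)
  next
    case 3
    with OO(1)[OF graph_of_degree_g5[of a c]] show ?thesis
      by (simp add: log_degree_def type_exponent_def link_def gpoly_def)
  qed
qed

text \<open>No information is lost by forgetting \<open>y\<^sub>i\<close>: it is determined by \<open>x\<^sub>i\<^sub>+\<^sub>1\<close> through the inverse of the
  Moebius map \<open>h\<close>.\<close>

lemma finite_fiber_product:
  assumes "finite (loops (link p1 (hpoly f1)) (link p2 (hpoly f2))
                         (link p3 (hpoly f3)) (link p4 (hpoly f4)))"
  shows "finite (fiber_product (p1, hpoly f1, p2, hpoly f2) (p3, hpoly f3, p4, hpoly f4))"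
proof (rule finite_imageD)
  let ?F = "fiber_product (p1, hpoly f1, p2, hpoly f2) (p3, hpoly f3, p4, hpoly f4)"
  let ?\<pi> = "\<lambda>((x1, x2, x3, y1, y2), (x3', x4, x1', y3, y4)). (x1 :: cp1, x2 :: cp1, x3 :: cp1, x4 :: cp1)"
  have "?\<pi> ` ?F \<subseteq> loops (link p1 (hpoly f1)) (link p2 (hpoly f2))
      (link p3 (hpoly f3)) (link p4 (hpoly f4))"
    by (auto simp: fiber_product_def loops_def link_def)
  then show "finite (?\<pi> ` ?F)" using assms by (rule finite_subset)
  have "y = y'" if "vanishes_at (hpoly f) y x" "vanishes_at (hpoly f) y' x" for f x y y'
    using graph_of_degree_functional[OF graph_of_degree_hpoly(2), of f x y y'] that by simp
  then show "inj_on ?\<pi> ?F"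
    by (fastforce simp: inj_on_def fiber_product_def)
qed

text \<open>Besides the excluded vector, the balanced ones have the entries 1, 1, 3, 5 or 3, 3, 5, 5
  in some order, and each of them can be shifted so that the first two and the last two
  entries are paired as claimed: 1, 1, 3, 5 in this order is shifted to 1, 3, 5, 1, for example.\<close>

lemma balanced_types:
  fixes j :: "nat \<Rightarrow> nat"
  assumes j: "j 1 \<in> {1, 3, 5}" "j 2 \<in> {1, 3, 5}" "j 3 \<in> {1, 3, 5}" "j 4 \<in> {1, 3, 5}"
    and not_all_1: "\<not> (j 1 = 1 \<and> j 2 = 1 \<and> j 3 = 1 \<and> j 4 = 1)"
    and sum: "type_exponent (j 1) + type_exponent (j 2)
            + type_exponent (j 3) + type_exponent (j 4) = 0"
  shows "\<exists>s<4. let j' = j \<circ> (cycle4 ^^ s) in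
           ({#j' 1, j' 2#} = {#1, 3#} \<and> {#j' 3, j' 4#} = {#1, 5#}) \<or>
           ({#j' 1, j' 2#} = {#3, 5#} \<and> {#j' 3, j' 4#} = {#3, 5#})"
proof -
  have ex4: "(\<exists>s<4. R s) \<longleftrightarrow> R 0 \<or> R 1 \<or> R 2 \<or> R 3" for R :: "nat \<Rightarrow> bool"
    by (auto simp: numeral_eq_Suc less_Suc_eq)
  have pair: "{#x, y#} = {#p, q#} \<longleftrightarrow> x = p \<and> y = q \<or> x = q \<and> y = p" for x y p q :: nat
    by (auto simp: add_eq_conv_ex)
  have shifts: "(j \<circ> cycle4 ^^ s) i = j ((cycle4 ^^ s) i)" for s i by simp
  have cycle: "(cycle4 ^^ 0) i = i" "(cycle4 ^^ 1) i = cycle4 i"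
    "(cycle4 ^^ 2) i = cycle4 (cycle4 i)" "(cycle4 ^^ 3) i = cycle4 (cycle4 (cycle4 i))" for i
    by (simp_all add: numeral_2_eq_2 numeral_3_eq_3)
  have succ: "cycle4 1 = 2" "cycle4 2 = 3" "cycle4 3 = 4" "cycle4 4 = 1"
    by (simp_all add: cycle4_def)
  have exponent: "type_exponent 1 = 0" "type_exponent 3 = -1" "type_exponent 5 = 1"
    by (simp_all add: type_exponent_def)
  show ?thesis
    unfolding ex4 Let_def pair shifts cycle succ
    using j not_all_1 sum
    by (elim insertE emptyE) (simp_all only: exponent, simp_all)
qed

theorem theorem7p9:
  fixes f k a b c :: "nat \<Rightarrow> real" and j :: "nat \<Rightarrow> nat"
    and g h :: "nat \<Rightarrow> bipoly" and S1 S2 :: coupling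
  assumes f: "\<forall>i\<in>{1..4}. -1 < f i \<and> f i \<le> 1"
    and coeffs: "\<forall>i\<in>{1..4}. j i \<in> {1, 3, 5} \<and> admissible (j i) (k i) (a i) (b i) (c i)"
    and g: "\<forall>i\<in>{1..4}. g i = gpoly (j i) (k i) (a i) (b i) (c i)"
    and h: "\<forall>i\<in>{1..4}. h i = hpoly (f i)"
    and S1: "S1 = (g 1, h 1, g 2, h 2)"
    and S2: "S2 = (g 3, h 3, g 4, h 4)"
    and not_all_1: "\<not> (\<forall>i\<in>{1..4}. j i = 1)"
    and inf: "infinite (fiber_product S1 S2)"
  shows "\<exists>s<4. let j' = j \<circ> (cycle4 ^^ s) in
           ({#j' 1, j' 2#} = {#1, 3#} \<and> {#j' 3, j' 4#} = {#1, 5#}) \<or>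
           ({#j' 1, j' 2#} = {#3, 5#} \<and> {#j' 3, j' 4#} = {#3, 5#})"
proof (rule balanced_types)
  show "j 1 \<in> {1, 3, 5}" "j 2 \<in> {1, 3, 5}" "j 3 \<in> {1, 3, 5}" "j 4 \<in> {1, 3, 5}"
    using coeffs by simp_all
  have "{1..4} = {1, 2, 3, 4 :: nat}" by auto
  with not_all_1 show "\<not> (j 1 = 1 \<and> j 2 = 1 \<and> j 3 = 1 \<and> j 4 = 1)" by simp
  have link: "log_degree (type_exponent (j i)) (link (g i) (h i))" if "i \<in> {1..4}" for i
    using that coeffs g h by (simp add: log_degree_link)
  have bound: "\<bar>type_exponent i\<bar> \<le> 1" for i by (simp add: type_exponent_def)
  show "type_exponent (j 1) + type_exponent (j 2)
      + type_exponent (j 3) + type_exponent (j 4) = 0"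
  proof (rule ccontr)
    assume "\<not> ?thesis"
    then have "finite (loops (link (g 1) (h 1)) (link (g 2) (h 2))
        (link (g 3) (h 3)) (link (g 4) (h 4)))"
      by (intro finite_loops_unbalanced[OF link link link link] bound) simp_all
    then have "finite (fiber_product S1 S2)"
      using h finite_fiber_product by (simp add: S1 S2)
    with inf show False ..
  qed
qed

end
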